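(* For all integers $n\ge 2$, \[ b(n,2)=p(n,2)=3E(n-1,2)-2\binom{n}{3}+\binom{n}{2}-1. \]
   Context: For a permutation $\pi=\pi_1\cdots\pi_n\in S_n$, a position $i\in\{1,\dots,n-1\}$ is an ascent if $\pi_i<\pi_{i+1}$ and a descent if $\pi_i>\pi_{i+1}$. The permutation $\pi$ is called ballot if for every $1\le k\le n-1$, the number of ascents among positions $1,\dots,k$ is at least the number of descents among positions $1,\dots,k$. Let $b(n,d)$ be the number of ballot permutations in $S_n$ with exactly $d$ descents. For a cycle $\mathfrak c=(c_1,\dots,c_k)$ of a permutation (fixed points are cycles of length 1), let $\mathrm{cA}(\mathfrak c)$ be the number of $i\in\{1,\dots,k\}$ with $c_i\le c_{i+1}$ and $\mathrm{cD}(\mathfrak c)$ the number with $c_i>c_{i+1}$, where $c_{k+1}=c_1$; let $M(\mathfrak c)=\min(\mathrm{cA}(\mathfrak c),\mathrm{cD}(\mathfrak c))$, and for a permutation $\pi$ let $M(\pi)$ be the sum of $M$ over its cycles. Let $p(n,d)$ be the number of permutations in $S_n$ all of whose cycles have odd length and with $M(\pi)=d$. $E(n,d)$ denotes the Eulerian number: the number of permutations of $[n]$ with exactly $d$ descents, with $E(0,0)=1$ and $E(0,d)=0$ for $d\ge1$. *)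

theory Defs
  imports "HOL-Combinatorics.Cycles"
begin

definition ascents :: "nat \<Rightarrow> (nat \<Rightarrow> nat) \<Rightarrow> nat set" where
  "ascents n \<pi> = {i \<in> {1..<n}. \<pi> i < \<pi> (i + 1)}"

definition descents :: "nat \<Rightarrow> (nat \<Rightarrow> nat) \<Rightarrow> nat set" where
  "descents n \<pi> = {i \<in> {1..<n}. \<pi> i > \<pi> (i + 1)}"

definition ballot :: "nat \<Rightarrow> (nat \<Rightarrow> nat) \<Rightarrow> bool" where
  "ballot n \<pi> \<longleftrightarrow>
     (\<forall>k\<in>{1..<n}. card (ascents n \<pi> \<inter> {1..k}) \<ge> card (descents n \<pi> \<inter> {1..k}))"

definition ballot_number :: "nat \<Rightarrow> nat \<Rightarrow> nat" where
  "ballot_number n d =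
     card {\<pi>. \<pi> permutes {1..n} \<and> ballot n \<pi> \<and> card (descents n \<pi>) = d}"

text \<open>A cycle \<open>(c\<^sub>1, \<dots>, c\<^sub>k)\<close> is the list \<open>[c\<^sub>1, \<dots>, c\<^sub>k]\<close>; list indices start
  at \<open>0\<close> and are read modulo the length, which implements \<open>c\<^bsub>k+1\<^esub> = c\<^sub>1\<close>.\<close>

definition cA :: "nat list \<Rightarrow> nat" where
  "cA c = card {i \<in> {..<length c}. c ! i \<le> c ! (Suc i mod length c)}"

definition cD :: "nat list \<Rightarrow> nat" where
  "cD c = card {i \<in> {..<length c}. c ! i > c ! (Suc i mod length c)}"

definition cycle_M :: "nat list \<Rightarrow> nat" where
  "cycle_M c = min (cA c) (cD c)"

text \<open>The list \<open>support \<pi> x\<close> is \<open>[x, \<pi> x, \<pi> (\<pi> x), \<dots>]\<close> up to the first return to \<open>x\<close>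
  (so \<open>[x]\<close> for a fixed point). Each cycle is represented once, by the rotation that
  starts with its least element.\<close>

definition perm_cycles :: "nat \<Rightarrow> (nat \<Rightarrow> nat) \<Rightarrow> nat list set" where
  "perm_cycles n \<pi> = {support \<pi> x | x. x \<in> {1..n} \<and> (\<forall>y \<in> set (support \<pi> x). x \<le> y)}"

definition perm_M :: "nat \<Rightarrow> (nat \<Rightarrow> nat) \<Rightarrow> nat" where
  "perm_M n \<pi> = (\<Sum>c\<in>perm_cycles n \<pi>. cycle_M c)"

definition odd_cycle_number :: "nat \<Rightarrow> nat \<Rightarrow> nat" where
  "odd_cycle_number n d =
     card {\<pi>. \<pi> permutes {1..n} \<and> (\<forall>c\<in>perm_cycles n \<pi>. odd (length c)) \<and> perm_M n \<pi> = d}"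

definition eulerian :: "nat \<Rightarrow> nat \<Rightarrow> nat" where
  "eulerian n d = card {\<pi>. \<pi> permutes {1..n} \<and> card (descents n \<pi>) = d}"

lemma eulerian_0: "eulerian 0 d = (if d = 0 then 1 else 0)"
  by (simp add: eulerian_def descents_def)

end

theory Submission
  imports Defs "HOL-Combinatorics.Multiset_Permutations"
begin

text \<open>Both counts equal \<open>3 ^ n - 3 * n * 2 ^ (n - 1) + 4 * (n choose 2) - 2 * (n choose 3) - 1\<close>.

  The lists whose descents lie in a prescribed set are counted by multinomial coefficients, since
  their pieces between the prescribed positions are increasing. Inclusion-exclusion then counts the
  permutations with descent set exactly \<open>{i, j}\<close>. Summing over all \<open>i < j\<close> gives the
  Eulerian number, and the permutations with two descents that are not ballot are those with
  descent set \<open>{1, j}\<close> or \<open>{2, 3}\<close>.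

  A permutation is determined by its nontrivial cycles, which partition the set \<open>U\<close> of
  moved points. Removing the least element from a cycle turns its cyclic descents into descents, and
  reversal exchanges cyclic ascents and descents. So on an odd number \<open>m\<close> of points there are
  two cycles with \<open>M = 1\<close> for \<open>m \<ge> 3\<close>, and \<open>2 ^ m - 2 * m\<close> cycles with \<open>M = 2\<close>
  for \<open>m \<ge> 5\<close>. For even \<open>m \<ge> 4\<close> the former yield \<open>2 ^ m - 4 * m\<close> partitions
  into two odd cycles with \<open>M = 1\<close>. Altogether a set \<open>U\<close> of size \<open>m > 3\<close> contributes
  \<open>2 ^ m - (3 + (-1) ^ m) * m\<close>, and the sum of \<open>(-1) ^ m * m * (n choose m)\<close> over \<open>m\<close>
  vanishes for \<open>n \<ge> 2\<close>.\<close>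

section \<open>Finite sums and binomial coefficients\<close>

lemma card_eq_sum_card_fibres:
  assumes "finite X" "finite Y" "g ` X \<subseteq> Y"
  shows "card X = (\<Sum>y\<in>Y. card {x \<in> X. g x = y})"
  using sum_fun_comp[OF assms, of "\<lambda>_. 1 :: nat"] by simp

lemma sum_Pow_card:
  assumes "finite A"
  shows "(\<Sum>B\<in>Pow A. g (card B)) = (\<Sum>k\<le>card A. of_nat (card A choose k) * g k)"
proof -
  have "(\<Sum>B\<in>Pow A. g (card B)) = (\<Sum>k\<le>card A. of_nat (card {B \<in> Pow A. card B = k}) * g k)"
    using assms by (intro sum_fun_comp) (auto intro: card_mono)
  also have "\<dots> = (\<Sum>k\<le>card A. of_nat (card A choose k) * g k)"
    by (simp add: n_subsets[OF assms])
  finally show ?thesis .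
qed

lemma sum_eq_2_iff:
  fixes f :: "'a \<Rightarrow> nat"
  assumes "finite K" "\<forall>x\<in>K. 0 < f x"
  shows "sum f K = 2 \<longleftrightarrow> (\<exists>x. K = {x} \<and> f x = 2) \<or>
    (\<exists>x y. x \<noteq> y \<and> K = {x, y} \<and> f x = 1 \<and> f y = 1)"
proof
  assume two: "sum f K = 2"
  then obtain x where x: "x \<in> K" by (metis equals0I sum.empty zero_neq_numeral)
  have "f x + sum f (K - {x}) = 2" using two sum.remove[OF assms(1) x, of f] by simp
  moreover have "0 < f x" using assms(2) x by blast
  ultimately consider (single) "f x = 2" "sum f (K - {x}) = 0"
    | (pair) "f x = 1" "sum f (K - {x}) = 1" by linarith
  then show "(\<exists>x. K = {x} \<and> f x = 2) \<or> (\<exists>x y. x \<noteq> y \<and> K = {x, y} \<and> f x = 1 \<and> f y = 1)"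
  proof cases
    case single
    then have "K - {x} = {}" using assms by (force simp: sum_eq_0_iff)
    then have "K = {x}" using x by blast
    with single show ?thesis by blast
  next
    case pair
    then obtain y where "y \<in> K - {x}" "f y = 1" "\<forall>z\<in>K - {x}. y \<noteq> z \<longrightarrow> f z = 0"
      using sum_eq_1_iff[of "K - {x}" f] assms(1) by auto
    then have "x \<noteq> y" "K = {x, y}" "f y = 1" using assms(2) x by force+
    with pair show ?thesis by blast
  qed
qed auto

lemma two_card_unordered_pairs:
  assumes "finite R" "sym R" "irrefl R"
  shows "2 * card ((\<lambda>(x, y). {x, y}) ` R) = card R"
proof -
  have "card {p \<in> R. (\<lambda>(x, y). {x, y}) p = S} = 2"
    if S: "S \<in> (\<lambda>(x, y). {x, y}) ` R" for S
  proof -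
    obtain x y where xy: "S = {x, y}" "(x, y) \<in> R" using S by auto
    then have "{p \<in> R. (\<lambda>(x, y). {x, y}) p = S} = {(x, y), (y, x)}"
      using symD[OF assms(2)] by (auto simp: doubleton_eq_iff)
    moreover have "x \<noteq> y" using xy(2) assms(3) by (auto simp: irrefl_def)
    ultimately show ?thesis by simp
  qed
  then show ?thesis
    using card_eq_sum_card_fibres[OF assms(1) finite_imageI[OF assms(1)] subset_refl,
        of "\<lambda>(x, y). {x, y}"] by simp
qed

lemma two_subsets_atMost_eq_image:
  "{S. S \<subseteq> {..n} \<and> card S = 2} = (\<lambda>(j, i). {i, j}) ` (SIGMA j:{..n}. {..<j})" for n :: nat
proof (intro equalityI subsetI)
  fix S assume "S \<in> {S. S \<subseteq> {..n} \<and> card S = 2}"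
  then obtain i j where "S = {i, j}" "i < j" "j \<le> n"
    by (auto simp: card_2_iff) (metis insert_commute linorder_neqE_nat)
  then show "S \<in> (\<lambda>(j, i). {i, j}) ` (SIGMA j:{..n}. {..<j})" by force
qed (auto simp: card_2_iff)

lemma sum_two_subsets_atMost:
  "(\<Sum>S | S \<subseteq> {..n} \<and> card S = 2. f S) = (\<Sum>j\<le>n. \<Sum>i<j. f {i, j})" for n :: nat
proof -
  have "inj_on (\<lambda>(j, i). {i, j}) (SIGMA j:{..n}. {..<j})"
    by (auto simp: inj_on_def doubleton_eq_iff)
  then show ?thesis
    by (simp add: two_subsets_atMost_eq_image sum.reindex sum.Sigma case_prod_unfold)
qed

lemma two_times_choose_two: "2 * int (n choose 2) = int n * (int n - 1)"
  by (induction n) (simp_all add: numeral_2_eq_2 algebra_simps)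

lemma sum_choose_add_choose_below:
  "(\<Sum>j\<le>n. \<Sum>i<j. (n choose i) + (n choose j)) = n * 2 ^ n"
proof -
  have "(\<Sum>j\<le>n. \<Sum>i<j. n choose i) = (\<Sum>i<n. (n - i) * (n choose i))"
    by (simp add: sum.nested_swap')
  also have "\<dots> = (\<Sum>i\<le>n. (n - i) * (n choose i))"
    by (simp flip: lessThan_Suc_atMost)
  finally have "(\<Sum>j\<le>n. \<Sum>i<j. (n choose i) + (n choose j)) =
      (\<Sum>i\<le>n. (n - i) * (n choose i) + i * (n choose i))"
    by (simp add: sum.distrib)
  also have "\<dots> = (\<Sum>i\<le>n. n * (n choose i))"
    by (intro sum.cong) (simp_all flip: add_mult_distrib)
  also have "\<dots> = n * 2 ^ n"
    by (simp add: choose_row_sum flip: sum_distrib_left)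
  finally show ?thesis .
qed

lemma sum_choose_mult_choose_below:
  "(\<Sum>j\<le>n. \<Sum>i<j. int (n choose j) * int (j choose i)) = 3 ^ n - 2 ^ n"
proof -
  have "(\<Sum>i<j. int (j choose i)) = 2 ^ j - 1" for j
    using arg_cong[OF choose_row_sum[of j], of int]
    by (simp flip: lessThan_Suc_atMost)
  then have "(\<Sum>j\<le>n. \<Sum>i<j. int (n choose j) * int (j choose i)) =
      (\<Sum>j\<le>n. int (n choose j) * 2 ^ j) - (\<Sum>j\<le>n. int (n choose j))"
    by (simp add: sum_distrib_left[symmetric] right_diff_distrib sum_subtractf)
  also have "(\<Sum>j\<le>n. int (n choose j) * 2 ^ j) = 3 ^ n"
    using binomial_ring[of "2 :: int" 1 n] by simp
  also have "(\<Sum>j\<le>n. int (n choose j)) = 2 ^ n"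
    by (simp add: choose_row_sum flip: of_nat_sum)
  finally show ?thesis .
qed

lemma sum_choose_odd_inner:
  assumes "even n" "4 \<le> n"
  shows "(\<Sum>k | odd k \<and> 3 \<le> k \<and> k + 3 \<le> n. n choose k) + 2 * n = 2 ^ (n - 1)"
proof -
  let ?I = "{k. odd k \<and> 3 \<le> k \<and> k + 3 \<le> n}"
  have "{k. k \<le> n \<and> odd k} = ?I \<union> {1, n - 1}"
    using assms by (auto, presburger+)
  then have "(\<Sum>k | k \<le> n \<and> odd k. n choose k) = (\<Sum>k\<in>?I \<union> {1, n - 1}. n choose k)"
    by (rule sum.cong) (rule refl)
  also have "\<dots> = (\<Sum>k\<in>?I. n choose k) + (\<Sum>k\<in>{1, n - 1}. n choose k)"
  proof (rule sum.union_disjoint)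
    show "finite ?I" by (rule finite_subset[of _ "{..n}"]) auto
  qed auto
  also have "(\<Sum>k\<in>{1, n - 1}. n choose k) = 2 * n"
    using assms(2) binomial_symmetric[of 1 n] by simp
  also have "(\<Sum>k | k \<le> n \<and> odd k. n choose k) = 2 ^ (n - 1)"
  proof -
    have "2 * (\<Sum>k\<le>n. if odd k then int (n choose k) else 0) = 2 * 2 ^ (n - 1)"
      using choose_odd_sum[of n, where ?'a = int] assms(2) by (cases n) simp_all
    then have "int (\<Sum>k | k \<le> n \<and> odd k. n choose k) = int (2 ^ (n - 1))"
      by (simp add: sum.inter_filter if_distrib[where f = int] cong: if_cong flip: atMost_iff)
    then show ?thesis by (simp only: of_nat_eq_iff)
  qed
  finally show ?thesis by simp
qed

section \<open>Descents of lists\<close>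

definition list_descents :: "'a::linorder list \<Rightarrow> nat set" where
  "list_descents xs = Suc ` {i. Suc i < length xs \<and> xs ! Suc i < xs ! i}"

lemma list_descents_subset: "list_descents xs \<subseteq> {0<..<length xs}"
  by (auto simp: list_descents_def)

lemma finite_list_descents [simp]: "finite (list_descents xs)"
  by (rule finite_subset[OF list_descents_subset]) simp

lemma Suc_in_list_descents_iff:
  "Suc i \<in> list_descents xs \<longleftrightarrow> Suc i < length xs \<and> xs ! Suc i < xs ! i"
  by (auto simp: list_descents_def)

lemma card_list_descents_less:
  assumes "xs \<noteq> []"
  shows "card (list_descents xs) < length xs"
  using card_mono[OF _ list_descents_subset[of xs]] assms
  by (simp add: Suc_leI less_eq_Suc_le flip: length_greater_0_conv)

lemma list_descents_append:
  "list_descents (xs @ ys) = list_descents xs \<union>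
     (if xs \<noteq> [] \<and> ys \<noteq> [] \<and> hd ys < last xs then {length xs} else {}) \<union>
     (+) (length xs) ` list_descents ys" (is "_ = ?R")
proof (rule set_eqI)
  fix i
  show "i \<in> list_descents (xs @ ys) \<longleftrightarrow> i \<in> ?R"
  proof (cases i)
    case 0
    then show ?thesis by (auto simp: list_descents_def)
  next
    case (Suc j)
    consider (left) "Suc j < length xs" | (boundary) "Suc j = length xs" | (right) "length xs \<le> j"
      by linarith
    then show ?thesis
    proof cases
      case left
      then show ?thesis by (auto simp: Suc Suc_in_list_descents_iff nth_append)
    next
      case boundary
      then have len: "length xs = Suc j" and "xs \<noteq> []" by auto
      then have "last xs = xs ! j" by (simp add: last_conv_nth)
      then show ?thesis
        using len \<open>xs \<noteq> []\<close> list_descents_subset[of ys]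
        by (auto simp: Suc Suc_in_list_descents_iff nth_append hd_conv_nth)
    next
      case right
      then obtain k where "j = length xs + k" using le_Suc_ex by blast
      then show ?thesis by (auto simp: Suc Suc_in_list_descents_iff nth_append image_iff)
    qed
  qed
qed

lemma list_descents_eq_empty_iff: "list_descents xs = {} \<longleftrightarrow> sorted xs"
proof -
  have "list_descents xs = {} \<longleftrightarrow> (\<forall>i. Suc i < length xs \<longrightarrow> \<not> xs ! Suc i < xs ! i)"
    unfolding list_descents_def by blast
  then show ?thesis by (simp only: sorted_iff_nth_Suc not_less)
qed

lemma card_list_descents_rev:
  assumes "distinct xs"
  shows "card (list_descents (rev xs)) = length xs - 1 - card (list_descents xs)"
proof -
  let ?A = "{0<..<length xs} - list_descents xs"
  have "length xs - i \<in> list_descents (rev xs) \<longleftrightarrow> i \<in> ?A"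
    if bounds: "i \<in> {0<..<length xs}" for i
  proof -
    obtain j where i: "i = Suc j" and j: "Suc j < length xs"
      using bounds by (cases i) auto
    define k where "k = length xs - Suc i"
    then have k: "length xs - i = Suc k" "Suc k < length xs"
      and nth: "rev xs ! Suc k = xs ! j" "rev xs ! k = xs ! i"
      using i j by (simp_all add: rev_nth Suc_diff_Suc)
    have "xs ! j \<noteq> xs ! i" using nth_eq_iff_index_eq[OF assms, of j i] i j by simp
    moreover have "i \<in> list_descents xs \<longleftrightarrow> xs ! i < xs ! j"
      using j by (simp add: i Suc_in_list_descents_iff)
    ultimately show ?thesis
      using bounds k(2) by (auto simp: k(1) nth Suc_in_list_descents_iff)
  qed
  moreover have "bij_betw (\<lambda>i. length xs - i) {0<..<length xs} {0<..<length xs}"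
    by (rule bij_betw_byWitness[where f' = "\<lambda>i. length xs - i"]) auto
  ultimately have "bij_betw (\<lambda>i. length xs - i) {i \<in> {0<..<length xs}. i \<in> ?A}
     {i \<in> {0<..<length xs}. i \<in> list_descents (rev xs)}"
    by (intro bij_betw_Collect) simp_all
  moreover have "{i \<in> {0<..<length xs}. i \<in> ?A} = ?A"
    "{i \<in> {0<..<length xs}. i \<in> list_descents (rev xs)} = list_descents (rev xs)"
    using list_descents_subset[of "rev xs"] by auto
  ultimately have "card (list_descents (rev xs)) = card ?A"
    by (simp only: bij_betw_same_card)
  then show ?thesis
    using list_descents_subset[of xs] by (simp add: card_Diff_subset)
qed

section \<open>Counting permutations by their descent set\<close>

definition perms_with_descent_set :: "'a::linorder set \<Rightarrow> nat set \<Rightarrow> 'a list set" where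
  "perms_with_descent_set A S = {xs \<in> permutations_of_set A. list_descents xs = S}"

definition perms_with_descents_within :: "'a::linorder set \<Rightarrow> nat set \<Rightarrow> 'a list set" where
  "perms_with_descents_within A S = {xs \<in> permutations_of_set A. list_descents xs \<subseteq> S}"

definition perms_with_num_descents :: "'a::linorder set \<Rightarrow> nat \<Rightarrow> 'a list set" where
  "perms_with_num_descents A d = {xs \<in> permutations_of_set A. card (list_descents xs) = d}"

lemma list_descents_subset_atMost:
  assumes "xs \<in> permutations_of_set A"
  shows "list_descents xs \<subseteq> {..card A}"
  using list_descents_subset[of xs] length_finite_permutations_of_set[OF assms] by auto

lemma card_perms_list_descents_in:
  assumes "finite \<S>"
  shows "card {xs \<in> permutations_of_set A. list_descents xs \<in> \<S>} =
     (\<Sum>S\<in>\<S>. card (perms_with_descent_set A S))"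
proof -
  let ?X = "{xs \<in> permutations_of_set A. list_descents xs \<in> \<S>}"
  have "card ?X = (\<Sum>S\<in>\<S>. card {xs \<in> ?X. list_descents xs = S})"
    using assms by (intro card_eq_sum_card_fibres) auto
  also have "\<dots> = (\<Sum>S\<in>\<S>. card (perms_with_descent_set A S))"
    by (intro sum.cong arg_cong[of _ _ card]) (auto simp: perms_with_descent_set_def)
  finally show ?thesis .
qed

lemma perms_with_descent_set_empty:
  assumes "finite A"
  shows "perms_with_descent_set A {} = {sorted_list_of_set A}"
  using assms sorted_distinct_set_unique[of _ "sorted_list_of_set A"]
  by (auto simp: perms_with_descent_set_def list_descents_eq_empty_iff permutations_of_set_def)

lemma append_in_perms_with_descents_within_iff:
  "xs @ ys \<in> perms_with_descents_within A (insert (length xs) ((+) (length xs) ` S)) \<longleftrightarrow>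
    set xs \<subseteq> A \<and> distinct xs \<and> sorted xs \<and> ys \<in> perms_with_descents_within (A - set xs) S"
proof -
  let ?T = "insert (length xs) ((+) (length xs) ` S)"
  have "list_descents xs \<inter> ?T = {}" "length xs \<notin> (+) (length xs) ` list_descents ys"
    using list_descents_subset[of xs] list_descents_subset[of ys] by auto
  then have "list_descents xs \<subseteq> ?T \<longleftrightarrow> sorted xs"
    "(+) (length xs) ` list_descents ys \<subseteq> ?T \<longleftrightarrow> list_descents ys \<subseteq> S"
    by (auto simp: list_descents_eq_empty_iff[symmetric] subset_insert inj_image_subset_iff)
  then have "list_descents (xs @ ys) \<subseteq> ?T \<longleftrightarrow> sorted xs \<and> list_descents ys \<subseteq> S"
    by (simp add: list_descents_append)
  then show ?thesis
    by (auto simp: perms_with_descents_within_def permutations_of_set_def)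
qed

lemma bij_betw_sorted_list_append:
  assumes "finite A" "i \<le> card A"
  shows "bij_betw (\<lambda>(B, ys). sorted_list_of_set B @ ys)
    (SIGMA B:{B. B \<subseteq> A \<and> card B = i}. perms_with_descents_within (A - B) S)
    (perms_with_descents_within A (insert i ((+) i ` S)))"
    (is "bij_betw ?f ?pairs ?lists")
proof (rule bij_betw_byWitness[where f' = "\<lambda>xs. (set (take i xs), drop i xs)"])
  have fin: "finite B" if "B \<subseteq> A" for B using that assms(1) by (rule finite_subset)
  then show "\<forall>p\<in>?pairs. (\<lambda>xs. (set (take i xs), drop i xs)) (?f p) = p" by auto
  show "?f ` ?pairs \<subseteq> ?lists"
  proof (rule image_subsetI)
    fix p assume "p \<in> ?pairs"
    then obtain B ys where "p = (B, ys)" and B: "B \<subseteq> A" "card B = i"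
      and "ys \<in> perms_with_descents_within (A - B) S" by blast
    then show "?f p \<in> ?lists"
      using append_in_perms_with_descents_within_iff[of "sorted_list_of_set B" ys A S] fin[OF B(1)]
      by simp
  qed
  have split: "set (take i xs) \<subseteq> A \<and> distinct (take i xs) \<and> sorted (take i xs) \<and>
      card (set (take i xs)) = i \<and> drop i xs \<in> perms_with_descents_within (A - set (take i xs)) S"
    if xs: "xs \<in> ?lists" for xs
  proof -
    have "length (take i xs) = i"
      using xs assms(2) length_finite_permutations_of_set[of xs A]
      by (simp add: perms_with_descents_within_def)
    then show ?thesis
      using append_in_perms_with_descents_within_iff[of "take i xs" "drop i xs" A S] xs
        distinct_card[of "take i xs"] by simp
  qed
  show "\<forall>xs\<in>?lists. ?f (set (take i xs), drop i xs) = xs"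
    using split by (simp add: sorted_list_of_set.idem_if_sorted_distinct)
  show "(\<lambda>xs. (set (take i xs), drop i xs)) ` ?lists \<subseteq> ?pairs"
    using split by auto
qed

lemma card_perms_with_descents_within_insert:
  assumes "finite A" "i \<le> card A"
  shows "card (perms_with_descents_within A (insert i ((+) i ` S))) =
    (\<Sum>B | B \<subseteq> A \<and> card B = i. card (perms_with_descents_within (A - B) S))"
  unfolding bij_betw_same_card[OF bij_betw_sorted_list_append[OF assms], symmetric]
  using assms(1) by (intro card_SigmaI) (auto simp: perms_with_descents_within_def)

lemma card_perms_with_descents_within_empty:
  assumes "finite A"
  shows "card (perms_with_descents_within A {}) = 1"
  using perms_with_descent_set_empty[OF assms]
  by (simp add: perms_with_descent_set_def perms_with_descents_within_def)

lemma card_perms_with_descents_within_singleton: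
  assumes "finite A" "i \<le> card A"
  shows "card (perms_with_descents_within A {i}) = card A choose i"
  using card_perms_with_descents_within_insert[OF assms, of "{}"] assms(1)
  by (simp add: card_perms_with_descents_within_empty n_subsets)

lemma card_perms_with_descents_within_doubleton:
  assumes "finite A" "i < j" "j \<le> card A"
  shows "card (perms_with_descents_within A {i, j}) = (card A choose j) * (j choose i)"
proof -
  let ?B = "{B. B \<subseteq> A \<and> card B = i}"
  have "card (perms_with_descents_within (A - B) {j - i}) = (card A - i) choose (j - i)"
    if "B \<in> ?B" for B
  proof -
    have "finite (A - B)" "card (A - B) = card A - i"
      using that assms(1) by (auto simp: card_Diff_subset finite_subset)
    then show ?thesis using assms(2,3) by (simp add: card_perms_with_descents_within_singleton)
  qed
  moreover have "insert i ((+) i ` {j - i}) = {i, j}" using assms(2) by simp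
  ultimately have "card (perms_with_descents_within A {i, j}) =
      (card A choose i) * ((card A - i) choose (j - i))"
    using card_perms_with_descents_within_insert[of A i "{j - i}"] assms
    by (simp add: n_subsets)
  then show ?thesis
    using choose_mult[of i j "card A"] assms(2,3) by simp
qed

lemma card_perms_with_descents_within_eq_sum:
  assumes "finite S"
  shows "card (perms_with_descents_within A S) = (\<Sum>T\<in>Pow S. card (perms_with_descent_set A T))"
  using assms card_perms_list_descents_in[of "Pow S" A]
  by (simp add: perms_with_descents_within_def)

lemma card_perms_with_descent_set_singleton:
  assumes "finite A" "i \<le> card A"
  shows "int (card (perms_with_descent_set A {i})) = int (card A choose i) - 1"
  using card_perms_with_descents_within_eq_sum[of "{i}" A] assms
  by (simp add: card_perms_with_descents_within_singleton perms_with_descent_set_empty Pow_insert)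

lemma card_perms_with_descent_set_doubleton:
  assumes "finite A" "i < j" "j \<le> card A"
  shows "int (card (perms_with_descent_set A {i, j})) =
    int (card A choose j) * int (j choose i) - int (card A choose i) - int (card A choose j) + 1"
proof -
  have "(card A choose j) * (j choose i) = card (perms_with_descent_set A {i, j}) +
      card (perms_with_descent_set A {i}) + card (perms_with_descent_set A {j}) + 1"
    using card_perms_with_descents_within_eq_sum[of "{i, j}" A] assms
    by (simp add: card_perms_with_descents_within_doubleton perms_with_descent_set_empty
        Pow_insert doubleton_eq_iff)
  from arg_cong[OF this, of int] show ?thesis
    using assms by (simp add: card_perms_with_descent_set_singleton)
qed

lemma card_perms_with_num_descents_symmetric:
  assumes "d < card A"
  shows "card (perms_with_num_descents A (card A - 1 - d)) = card (perms_with_num_descents A d)"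
proof -
  have "card (list_descents (rev xs)) = card A - 1 - d \<longleftrightarrow> card (list_descents xs) = d"
    if "xs \<in> permutations_of_set A" for xs
  proof -
    have "distinct xs" "length xs = card A"
      using that by (auto simp: permutations_of_set_def distinct_card)
    moreover have "card (list_descents xs) < length xs"
      using assms calculation(2) by (intro card_list_descents_less) auto
    ultimately show ?thesis using assms by (simp add: card_list_descents_rev) linarith
  qed
  moreover have "bij_betw rev (permutations_of_set A) (permutations_of_set A)"
    by (simp add: bij_betw_def)
  ultimately show ?thesis
    unfolding perms_with_num_descents_def
    by (intro bij_betw_same_card[symmetric] bij_betw_Collect)
qed

lemma card_perms_with_num_descents_0:
  assumes "finite A"
  shows "card (perms_with_num_descents A 0) = 1"
  using perms_with_descent_set_empty[OF assms]
  by (simp add: perms_with_descent_set_def perms_with_num_descents_def)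

lemma card_perms_with_num_descents_1:
  assumes "finite A"
  shows "int (card (perms_with_num_descents A 1)) = 2 ^ card A - int (card A) - 1"
proof -
  let ?n = "card A"
  have "list_descents xs \<in> (\<lambda>i. {i}) ` {..?n} \<longleftrightarrow> card (list_descents xs) = 1"
    if "xs \<in> permutations_of_set A" for xs
    using list_descents_subset_atMost[OF that] by (auto simp: card_1_singleton_iff)
  then have "perms_with_num_descents A 1 =
      {xs \<in> permutations_of_set A. list_descents xs \<in> (\<lambda>i. {i}) ` {..?n}}"
    unfolding perms_with_num_descents_def by blast
  also have "int (card \<dots>) = (\<Sum>i\<le>?n. int (card (perms_with_descent_set A {i})))"
    by (simp add: card_perms_list_descents_in sum.reindex)
  also have "\<dots> = (\<Sum>i\<le>?n. int (?n choose i) - 1)"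
    using assms by (intro sum.cong) (simp_all add: card_perms_with_descent_set_singleton)
  also have "\<dots> = 2 ^ ?n - int ?n - 1"
    by (simp add: sum_subtractf choose_row_sum flip: of_nat_sum)
  finally show ?thesis .
qed

lemma card_perms_with_num_descents_2:
  assumes "finite A"
  shows "int (card (perms_with_num_descents A 2)) =
    3 ^ card A - (int (card A) + 1) * 2 ^ card A + int (Suc (card A) choose 2)"
proof -
  let ?n = "card A"
  have "perms_with_num_descents A 2 =
      {xs \<in> permutations_of_set A. list_descents xs \<in> {S. S \<subseteq> {..?n} \<and> card S = 2}}"
    unfolding perms_with_num_descents_def using list_descents_subset_atMost by blast
  also have "int (card \<dots>) = (\<Sum>j\<le>?n. \<Sum>i<j. int (card (perms_with_descent_set A {i, j})))"
    by (subst card_perms_list_descents_in)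
      (simp_all add: sum_two_subsets_atMost del: mem_Collect_eq)
  also have "\<dots> = (\<Sum>j\<le>?n. \<Sum>i<j. int (?n choose j) * int (j choose i)
      - int ((?n choose i) + (?n choose j)) + 1)"
    using assms by (intro sum.cong) (simp_all add: card_perms_with_descent_set_doubleton)
  also have "\<dots> = (\<Sum>j\<le>?n. \<Sum>i<j. int (?n choose j) * int (j choose i))
      - int (\<Sum>j\<le>?n. \<Sum>i<j. (?n choose i) + (?n choose j)) + int (\<Sum>j\<le>?n. j)"
    by (simp add: sum.distrib sum_subtractf)
  also have "\<dots> = 3 ^ ?n - 2 ^ ?n - int (?n * 2 ^ ?n) + int (\<Sum>j\<le>?n. j)"
    by (simp only: sum_choose_mult_choose_below sum_choose_add_choose_below)
  also have "(\<Sum>j\<le>?n. j) = Suc ?n choose 2"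
    by (simp add: choose_two gauss_sum_nat atMost_atLeast0)
  finally show ?thesis by (simp add: algebra_simps)
qed

lemma sum_card_perms_with_descent_set_1:
  assumes "finite A" "A \<noteq> {}"
  shows "(\<Sum>j=2..card A. int (card (perms_with_descent_set A {1, j}))) =
    int (card A) * 2 ^ (card A - 1) - 2 ^ card A - (int (card A))\<^sup>2 + 2 * int (card A)"
proof -
  let ?n = "card A"
  let ?f = "\<lambda>j. int (j * (?n choose j)) - int (?n choose j) - int ?n + 1"
  have pos: "1 \<le> ?n" using assms by (simp add: Suc_leI card_gt_0_iff)
  have "(\<Sum>j=2..?n. int (card (perms_with_descent_set A {1, j}))) = (\<Sum>j=2..?n. ?f j)"
    using assms(1) by (intro sum.cong) (simp_all add: card_perms_with_descent_set_doubleton)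
  also have "\<dots> = (\<Sum>j\<le>?n. ?f j) - ?f 0 - ?f 1"
  proof -
    have "{..?n} = insert 0 (insert 1 {2..?n})" using pos by auto
    then show ?thesis by simp
  qed
  also have "(\<Sum>j\<le>?n. ?f j) = int (?n * 2 ^ (?n - 1)) - int (2 ^ ?n) - int (Suc ?n) * (int ?n - 1)"
  proof -
    have "(\<Sum>j\<le>?n. ?f j) = int (\<Sum>j\<le>?n. j * (?n choose j)) - int (\<Sum>j\<le>?n. ?n choose j)
        - int (Suc ?n) * (int ?n - 1)"
      by (simp add: sum.distrib sum_subtractf algebra_simps)
    then show ?thesis by (simp only: choose_linear_sum choose_row_sum)
  qed
  finally show ?thesis by (simp add: algebra_simps power2_eq_square)
qed

section \<open>Ballot permutations with two descents\<close>

lemma descents_eq_list_descents: "descents n \<pi> = list_descents (map \<pi> [1..<Suc n])"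
proof (rule set_eqI)
  fix i
  show "i \<in> descents n \<pi> \<longleftrightarrow> i \<in> list_descents (map \<pi> [1..<Suc n])"
    by (cases i)
      (auto simp: descents_def Suc_in_list_descents_iff list_descents_def simp del: upt_Suc)
qed

lemma bij_betw_permutes_permutations_of_set:
  "bij_betw (\<lambda>\<pi>. map \<pi> [1..<Suc n]) {\<pi>. \<pi> permutes {1..n}} (permutations_of_set {1..n})"
proof -
  let ?f = "\<lambda>\<pi>. map \<pi> [1..<Suc n]"
  have inj: "inj_on ?f {\<pi>. \<pi> permutes {1..n}}"
  proof (rule inj_onI, rule ext)
    fix \<pi> \<sigma> x assume "\<pi> \<in> {\<pi>. \<pi> permutes {1..n}}" "\<sigma> \<in> {\<pi>. \<pi> permutes {1..n}}" "?f \<pi> = ?f \<sigma>"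
    then show "\<pi> x = \<sigma> x"
      by (cases "x \<in> {1..n}") (auto simp: permutes_not_in simp del: upt_Suc)
  qed
  moreover have "?f ` {\<pi>. \<pi> permutes {1..n}} = permutations_of_set {1..n}"
  proof (rule card_subset_eq)
    have "?f \<pi> \<in> permutations_of_set {1..n}" if "\<pi> permutes {1..n}" for \<pi>
      using permutes_image[OF that] permutes_inj_on[OF that]
      by (simp add: permutations_of_set_def distinct_map atLeastLessThanSuc_atLeastAtMost
          del: upt_Suc)
    then show "?f ` {\<pi>. \<pi> permutes {1..n}} \<subseteq> permutations_of_set {1..n}" by blast
    show "card (?f ` {\<pi>. \<pi> permutes {1..n}}) = card (permutations_of_set {1..n})"
      unfolding card_image[OF inj] by (simp add: card_permutations[OF refl])
  qed simp
  ultimately show ?thesis by (simp add: bij_betw_def)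
qed

lemma card_permutes_descents:
  "card {\<pi>. \<pi> permutes {1..n} \<and> P (descents n \<pi>)} =
   card {xs \<in> permutations_of_set {1..n}. P (list_descents xs)}"
proof -
  have "bij_betw (\<lambda>\<pi>. map \<pi> [1..<Suc n]) {\<pi> \<in> {\<pi>. \<pi> permutes {1..n}}. P (descents n \<pi>)}
      {xs \<in> permutations_of_set {1..n}. P (list_descents xs)}"
    by (rule bij_betw_Collect[OF bij_betw_permutes_permutations_of_set])
      (simp only: descents_eq_list_descents)
  then show ?thesis by (simp add: bij_betw_same_card)
qed

lemma eulerian_eq_card_perms_with_num_descents:
  "eulerian n d = card (perms_with_num_descents {1..n} d)"
  using card_permutes_descents[of n "\<lambda>S. card S = d"]
  by (simp add: eulerian_def perms_with_num_descents_def)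

lemma eulerian_2: "int (eulerian n 2) = 3 ^ n - (int n + 1) * 2 ^ n + int (Suc n choose 2)"
  using card_perms_with_num_descents_2[of "{1..n}"]
  by (simp add: eulerian_eq_card_perms_with_num_descents)

lemma ballot_iff_descents:
  assumes "\<pi> permutes {1..n}"
  shows "ballot n \<pi> \<longleftrightarrow> (\<forall>k\<in>{1..<n}. 2 * card (descents n \<pi> \<inter> {1..k}) \<le> k)"
proof -
  have ascents: "ascents n \<pi> = {1..<n} - descents n \<pi>"
  proof -
    have "\<pi> i \<noteq> \<pi> (i + 1)" for i using permutes_inj[OF assms] by (simp add: inj_eq)
    then show ?thesis unfolding ascents_def descents_def by (auto simp: nat_neq_iff)
  qed
  have "card (descents n \<pi> \<inter> {1..k}) \<le> card (ascents n \<pi> \<inter> {1..k}) \<longleftrightarrow>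
      2 * card (descents n \<pi> \<inter> {1..k}) \<le> k" if "k \<in> {1..<n}" for k
  proof -
    have "ascents n \<pi> \<inter> {1..k} = {1..k} - descents n \<pi> \<inter> {1..k}"
      using that by (auto simp: ascents)
    then have "card (ascents n \<pi> \<inter> {1..k}) = k - card (descents n \<pi> \<inter> {1..k})"
      by (simp add: card_Diff_subset)
    then show ?thesis by linarith
  qed
  then show ?thesis by (simp add: ballot_def)
qed

lemma ballot_two_descents_iff:
  assumes "\<pi> permutes {1..n}" "descents n \<pi> = {i, j}" "i < j"
  shows "ballot n \<pi> \<longleftrightarrow> 2 \<le> i \<and> 4 \<le> j"
proof -
  have "i \<in> descents n \<pi>" "j \<in> descents n \<pi>" using assms(2) by auto
  then have bounds: "1 \<le> i" "j < n" by (simp_all add: descents_def)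
  have count: "card ({i, j} \<inter> {1..k}) = (if k < i then 0 else if k < j then 1 else 2)" for k
  proof -
    have "{i, j} \<inter> {1..k} = (if k < i then {} else if k < j then {i} else {i, j})"
      using assms(3) bounds by auto
    then show ?thesis using assms(3) by auto
  qed
  have "ballot n \<pi> \<longleftrightarrow> (\<forall>k\<in>{1..<n}. 2 * (if k < i then 0 else if k < j then 1 else 2) \<le> k)"
    by (simp only: ballot_iff_descents[OF assms(1)] assms(2) count)
  also have "\<dots> \<longleftrightarrow> 2 \<le> i \<and> 4 \<le> j"
  proof
    assume ballot: "\<forall>k\<in>{1..<n}. 2 * (if k < i then 0 else if k < j then 1 else 2) \<le> k"
    show "2 \<le> i \<and> 4 \<le> j"
      using bspec[OF ballot, of i] bspec[OF ballot, of j] bounds assms(3) by auto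
  qed auto
  finally show ?thesis .
qed

lemma not_ballot_two_descents_iff:
  assumes "\<pi> permutes {1..n}"
  shows "card (descents n \<pi>) = 2 \<and> \<not> ballot n \<pi> \<longleftrightarrow>
    descents n \<pi> \<in> insert {2, 3} ((\<lambda>j. {1, j}) ` {2..n})" (is "?L \<longleftrightarrow> ?R")
proof -
  have pair: "\<not> ballot n \<pi> \<longleftrightarrow> ?R" if desc: "descents n \<pi> = {i, j}" and "i < j" for i j
  proof -
    have "i \<in> descents n \<pi>" "j \<in> descents n \<pi>" using desc by auto
    then have "1 \<le> i" "j < n" by (simp_all add: descents_def)
    moreover have "{i, j} = {2, 3} \<longleftrightarrow> i = 2 \<and> j = 3"
      using \<open>i < j\<close> by (auto simp: doubleton_eq_iff)
    moreover have "{i, j} \<in> (\<lambda>j. {1, j}) ` {2..n} \<longleftrightarrow> i = 1 \<and> 2 \<le> j \<and> j \<le> n"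
      using \<open>i < j\<close> by (auto simp: image_iff doubleton_eq_iff)
    moreover have "\<not> ballot n \<pi> \<longleftrightarrow> i < 2 \<or> j < 4"
      using ballot_two_descents_iff[OF assms desc \<open>i < j\<close>] by auto
    ultimately show ?thesis
      using \<open>i < j\<close> unfolding desc insert_iff by linarith
  qed
  show ?thesis
  proof
    assume ?L
    then obtain i j where "descents n \<pi> = {i, j}" "i < j"
      by (auto simp: card_2_iff) (metis insert_commute linorder_neqE_nat)
    with \<open>?L\<close> pair show ?R by blast
  next
    assume ?R
    then obtain i j where "descents n \<pi> = {i, j}" "i < j" by auto
    moreover from this have "card (descents n \<pi>) = 2" by simp
    ultimately show ?L using \<open>?R\<close> pair by blast
  qed
qed

lemma card_perms_with_descent_set_2_3:
  assumes "finite A" "2 \<le> card A"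
  shows "int (card (perms_with_descent_set A {2, 3})) =
    2 * int (card A choose 3) - int (card A choose 2) + 1"
proof (cases "card A = 2")
  case True
  have "list_descents xs \<noteq> {2, 3}" if "xs \<in> permutations_of_set A" for xs
    using list_descents_subset[of xs] length_finite_permutations_of_set[OF that] True by auto
  then have "perms_with_descent_set A {2, 3} = {}" by (auto simp: perms_with_descent_set_def)
  then show ?thesis by (simp add: True)
next
  case False
  have "(3 choose 2) = (3 :: nat)" by (simp add: eval_nat_numeral)
  with False show ?thesis using card_perms_with_descent_set_doubleton[of A 2 3] assms by simp
qed

theorem ballot_number_2:
  assumes "2 \<le> n"
  shows "int (ballot_number n 2) =
    3 ^ n - 3 * int n * 2 ^ (n - 1) + 4 * int (n choose 2) - 2 * int (n choose 3) - 1"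
proof -
  let ?starts = "(\<lambda>j. {1, j}) ` {2..n}"
  let ?ballot = "{\<pi>. \<pi> permutes {1..n} \<and> ballot n \<pi> \<and> card (descents n \<pi>) = 2}"
  let ?rest = "{\<pi>. \<pi> permutes {1..n} \<and> descents n \<pi> \<in> insert {2, 3} ?starts}"
  have "eulerian n 2 = card (?ballot \<union> ?rest)"
    unfolding eulerian_def using not_ballot_two_descents_iff[of _ n]
    by (intro arg_cong[of _ _ card]) blast
  also have "\<dots> = card ?ballot + card ?rest"
    using not_ballot_two_descents_iff[of _ n]
    by (intro card_Un_disjoint) (auto intro: finite_subset[OF _ finite_permutations[of "{1..n}"]])
  also have "card ?rest = (\<Sum>S\<in>insert {2, 3} ?starts. card (perms_with_descent_set {1..n} S))"
    unfolding card_permutes_descents[of n "\<lambda>S. S \<in> insert {2, 3} ?starts"]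
    by (rule card_perms_list_descents_in) simp
  also have "\<dots> = card (perms_with_descent_set {1..n} {2, 3}) +
      (\<Sum>j=2..n. card (perms_with_descent_set {1..n} {1, j}))"
    by (subst sum.insert) (auto simp: sum.reindex inj_on_def doubleton_eq_iff)
  finally have "int (ballot_number n 2) =
      int (eulerian n 2) - int (card (perms_with_descent_set {1..n} {2, 3}))
      - (\<Sum>j=2..n. int (card (perms_with_descent_set {1..n} {1, j})))"
    by (simp add: ballot_number_def)
  moreover have "2 * int (n choose 2) = (int n)\<^sup>2 - int n"
    using two_times_choose_two[of n] by (simp add: power2_eq_square algebra_simps)
  moreover have "Suc n choose 2 = n + (n choose 2)" by (simp add: numeral_2_eq_2)
  moreover have "(2::int) ^ n = 2 * 2 ^ (n - 1)" using assms by (cases n) simp_all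
  ultimately show ?thesis
    using assms card_perms_with_descent_set_2_3[of "{1..n}"]
      sum_card_perms_with_descent_set_1[of "{1..n}"]
    by (simp add: eulerian_2 algebra_simps)
qed

section \<open>Cycles in terms of their least element\<close>

definition cycles_on :: "'a::linorder set \<Rightarrow> 'a list set" where
  "cycles_on A = {c \<in> permutations_of_set A. c \<noteq> [] \<and> (\<forall>x\<in>A. hd c \<le> x)}"

lemma finite_cycles_on [simp]: "finite (cycles_on A)"
  by (simp add: cycles_on_def)

lemma length_cycles_on: "c \<in> cycles_on A \<Longrightarrow> length c = card A"
  by (simp add: cycles_on_def length_finite_permutations_of_set)

lemma hd_eq_Min_if_cycles_on: "c \<in> cycles_on A \<Longrightarrow> hd c = Min A"
  by (rule Min_eqI[symmetric]) (auto simp: cycles_on_def permutations_of_set_def)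

lemma cycles_on_eq_image:
  assumes "finite A" "A \<noteq> {}"
  shows "cycles_on A = (#) (Min A) ` permutations_of_set (A - {Min A})"
proof (intro equalityI subsetI)
  fix c assume c: "c \<in> cycles_on A"
  then have "c = Min A # tl c"
    using hd_eq_Min_if_cycles_on[OF c] list.collapse[of c] by (simp add: cycles_on_def)
  moreover from this have "tl c \<in> permutations_of_set (A - {Min A})"
    using c by (cases c) (auto simp: cycles_on_def permutations_of_set_def)
  ultimately show "c \<in> (#) (Min A) ` permutations_of_set (A - {Min A})" by blast
next
  fix c assume "c \<in> (#) (Min A) ` permutations_of_set (A - {Min A})"
  then obtain ys where c: "c = Min A # ys" and ys: "set ys = A - {Min A}" "distinct ys"
    by (auto simp: permutations_of_set_def)
  have "set c = A" using ys(1) Min_in[OF assms] by (auto simp: c)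
  moreover have "distinct c" using ys by (simp add: c)
  moreover have "\<forall>x\<in>A. hd c \<le> x" using Min_le[OF assms(1)] by (simp add: c)
  ultimately show "c \<in> cycles_on A" by (auto simp: cycles_on_def c)
qed

lemma support_hd_eq_if_map_eq_rotate1:
  assumes "c \<noteq> []" "distinct c" "map \<pi> c = rotate1 c"
  shows "support \<pi> (hd c) = c"
proof -
  have "map (\<pi> ^^ i) c = rotate i c" for i
  proof (induction i)
    case (Suc i)
    have "map (\<pi> ^^ Suc i) c = map \<pi> (map (\<pi> ^^ i) c)" by simp
    also have "\<dots> = rotate i (rotate1 c)" by (simp only: Suc assms(3) flip: rotate_map)
    finally show ?case by (simp only: rotate_Suc rotate1_rotate_swap)
  qed simp
  then have iterate: "(\<pi> ^^ i) (hd c) = c ! (i mod length c)" for i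
    using assms(1) by (metis hd_map hd_rotate_conv_nth)
  have pos: "0 < length c" using assms(1) by simp
  have return: "(\<pi> ^^ i) (hd c) = hd c \<longleftrightarrow> length c dvd i" for i
  proof -
    have "(\<pi> ^^ i) (hd c) = hd c \<longleftrightarrow> c ! (i mod length c) = c ! 0"
      unfolding iterate using assms(1) by (simp add: hd_conv_nth)
    also have "\<dots> \<longleftrightarrow> i mod length c = 0"
      using pos by (intro nth_eq_iff_index_eq[OF assms(2)]) auto
    finally show ?thesis by (simp add: mod_eq_0_iff_dvd)
  qed
  have "least_power \<pi> (hd c) = length c"
    unfolding least_power_def return using pos by (intro Least_equality) (auto dest: dvd_imp_le)
  then show ?thesis by (intro nth_equalityI) (simp_all add: iterate)
qed

lemma map_support_eq_rotate1:
  assumes "permutation \<pi>"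
  shows "map \<pi> (support \<pi> x) = rotate1 (support \<pi> x)"
proof -
  have "map \<pi> (support \<pi> x) = map (cycle_of_list (support \<pi> x)) (support \<pi> x)"
    using cycle_restrict[OF assms] by (intro map_cong refl)
  also have "\<dots> = rotate1 (support \<pi> x)"
    using cyclic_rotation[OF cycle_of_permutation[OF assms], of 1] by simp
  finally show ?thesis .
qed

lemma in_set_support: "permutation \<pi> \<Longrightarrow> x \<in> set (support \<pi> x)"
  unfolding support_set by (metis funpow_0 rangeI)

lemma hd_support: "permutation \<pi> \<Longrightarrow> hd (support \<pi> x) = x"
  using least_power_of_permutation(2)[of \<pi> x] by (simp add: hd_map upt_conv_Cons)

lemma set_support_subset:
  assumes "\<pi> permutes S" "x \<in> S"
  shows "set (support \<pi> x) \<subseteq> S"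
  using permutes_in_image[OF permutes_funpow[OF assms(1)]] assms(2) by auto

lemma set_support_eq_if_common_element:
  assumes "permutation \<pi>" "z \<in> set (support \<pi> x)" "z \<in> set (support \<pi> y)"
  shows "set (support \<pi> x) = set (support \<pi> y)"
  using disjoint_support[OF assms(1)] assms(2,3) unfolding disjoint_def by blast

lemma perm_cycles_iff:
  assumes "\<pi> permutes {1..n}"
  shows "c \<in> perm_cycles n \<pi> \<longleftrightarrow>
    set c \<subseteq> {1..n} \<and> c \<in> cycles_on (set c) \<and> map \<pi> c = rotate1 c"
proof
  note perm = permutes_imp_permutation[OF finite_atLeastAtMost assms]
  assume "c \<in> perm_cycles n \<pi>"
  then obtain x where c: "c = support \<pi> x" and x: "x \<in> {1..n}" "\<forall>y\<in>set c. x \<le> y"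
    unfolding perm_cycles_def by blast
  have "c \<in> cycles_on (set c)"
    using cycle_of_permutation[OF perm, of x] hd_support[OF perm, of x]
      in_set_support[OF perm, of x] x(2)
    unfolding c cycles_on_def permutations_of_set_def by fastforce
  then show "set c \<subseteq> {1..n} \<and> c \<in> cycles_on (set c) \<and> map \<pi> c = rotate1 c"
    using set_support_subset[OF assms x(1)] map_support_eq_rotate1[OF perm] by (simp only: c)
next
  assume c: "set c \<subseteq> {1..n} \<and> c \<in> cycles_on (set c) \<and> map \<pi> c = rotate1 c"
  then have eq: "support \<pi> (hd c) = c"
    by (intro support_hd_eq_if_map_eq_rotate1) (auto simp: cycles_on_def permutations_of_set_def)
  have "hd c \<in> {1..n}" using c hd_in_set[of c] unfolding cycles_on_def by blast
  moreover have "\<forall>y\<in>set (support \<pi> (hd c)). hd c \<le> y"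
    using c unfolding eq cycles_on_def by blast
  ultimately have "support \<pi> (hd c) \<in> perm_cycles n \<pi>"
    unfolding perm_cycles_def by blast
  then show "c \<in> perm_cycles n \<pi>" by (simp only: eq)
qed

lemma finite_perm_cycles: "finite (perm_cycles n \<pi>)"
proof (rule finite_subset)
  show "perm_cycles n \<pi> \<subseteq> support \<pi> ` {1..n}" by (auto simp: perm_cycles_def)
qed simp

lemma Union_perm_cycles:
  assumes "\<pi> permutes {1..n}"
  shows "\<Union> (set ` perm_cycles n \<pi>) = {1..n}"
proof
  note perm = permutes_imp_permutation[OF finite_atLeastAtMost assms]
  show "\<Union> (set ` perm_cycles n \<pi>) \<subseteq> {1..n}" using perm_cycles_iff[OF assms] by blast
  show "{1..n} \<subseteq> \<Union> (set ` perm_cycles n \<pi>)"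
  proof
    fix x assume x: "x \<in> {1..n}"
    define m where "m = Min (set (support \<pi> x))"
    have "m \<in> set (support \<pi> x)"
      unfolding m_def using in_set_support[OF perm, of x] by (intro Min_in) auto
    then have same: "set (support \<pi> m) = set (support \<pi> x)" and "m \<in> {1..n}"
      using in_set_support[OF perm, of m] set_support_eq_if_common_element[OF perm]
        set_support_subset[OF assms x] by blast+
    moreover have "\<forall>y\<in>set (support \<pi> m). m \<le> y" unfolding same unfolding m_def by simp
    ultimately have "support \<pi> m \<in> perm_cycles n \<pi>" unfolding perm_cycles_def by blast
    then show "x \<in> \<Union> (set ` perm_cycles n \<pi>)" using same in_set_support[OF perm, of x] by blast
  qed
qed

lemma pairwise_disjnt_perm_cycles:
  assumes "\<pi> permutes {1..n}"
  shows "pairwise (\<lambda>c d. disjnt (set c) (set d)) (perm_cycles n \<pi>)"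
proof (rule pairwiseI, rule ccontr)
  note perm = permutes_imp_permutation[OF finite_atLeastAtMost assms]
  fix c d assume cd: "c \<in> perm_cycles n \<pi>" "d \<in> perm_cycles n \<pi>" "c \<noteq> d"
    and "\<not> disjnt (set c) (set d)"
  obtain x y where supports: "c = support \<pi> x" "d = support \<pi> y"
    using cd unfolding perm_cycles_def by blast
  have "set c = set d"
    using \<open>\<not> disjnt (set c) (set d)\<close> set_support_eq_if_common_element[OF perm]
    unfolding supports disjnt_iff by blast
  moreover have "hd c = Min (set c)" "hd d = Min (set d)"
    using cd hd_eq_Min_if_cycles_on by (auto simp: perm_cycles_iff[OF assms])
  ultimately have "hd c = hd d" by simp
  then have "x = y" unfolding supports hd_support[OF perm] .
  then show False using \<open>c \<noteq> d\<close> supports by simp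
qed

section \<open>Permutations as partitions into nontrivial cycles\<close>

definition nontrivial_cycles :: "nat \<Rightarrow> (nat \<Rightarrow> nat) \<Rightarrow> nat list set" where
  "nontrivial_cycles n \<pi> = {c \<in> perm_cycles n \<pi>. 2 \<le> length c}"

definition cycle_partitions :: "'a::linorder set \<Rightarrow> 'a list set set" where
  "cycle_partitions U = {K. (\<forall>c\<in>K. c \<in> cycles_on (set c) \<and> 2 \<le> length c) \<and>
     pairwise (\<lambda>c d. disjnt (set c) (set d)) K \<and> \<Union> (set ` K) = U}"

lemma not_fixed_if_map_eq_rotate1:
  assumes "map \<pi> c = rotate1 c" "distinct c" "2 \<le> length c" "x \<in> set c"
  shows "\<pi> x \<noteq> x"
proof -
  obtain i where i: "i < length c" "x = c ! i" using assms(4) by (auto simp: in_set_conv_nth)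
  have "\<pi> x = c ! (Suc i mod length c)" using i assms(1) by (metis nth_map nth_rotate1)
  moreover have "Suc i mod length c < length c" "Suc i mod length c \<noteq> i"
    using i(1) assms(3) by (auto simp: mod_Suc)
  ultimately show ?thesis using i nth_eq_iff_index_eq[OF assms(2)] by simp
qed

lemma Union_nontrivial_cycles:
  assumes "\<pi> permutes {1..n}"
  shows "\<Union> (set ` nontrivial_cycles n \<pi>) = {x. \<pi> x \<noteq> x}"
proof (intro equalityI subsetI)
  fix x assume "x \<in> \<Union> (set ` nontrivial_cycles n \<pi>)"
  then show "x \<in> {x. \<pi> x \<noteq> x}"
    using not_fixed_if_map_eq_rotate1[of \<pi>]
    by (auto simp: nontrivial_cycles_def perm_cycles_iff[OF assms] cycles_on_def
        permutations_of_set_def)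
next
  fix x assume "x \<in> {x. \<pi> x \<noteq> x}"
  then have moved: "\<pi> x \<noteq> x" by simp
  then have "x \<in> {1..n}" using permutes_not_in[OF assms] by blast
  then obtain c where c: "c \<in> perm_cycles n \<pi>" "x \<in> set c"
    using Union_perm_cycles[OF assms] by blast
  moreover have "2 \<le> length c"
  proof (rule ccontr)
    assume "\<not> 2 \<le> length c"
    with c(2) have "c = [x]" by (cases c; cases "tl c") auto
    with c(1) moved show False by (simp add: perm_cycles_iff[OF assms])
  qed
  ultimately show "x \<in> \<Union> (set ` nontrivial_cycles n \<pi>)" by (auto simp: nontrivial_cycles_def)
qed

lemma nontrivial_cycles_in_cycle_partitions:
  assumes "\<pi> permutes {1..n}"
  shows "nontrivial_cycles n \<pi> \<in> cycle_partitions {x. \<pi> x \<noteq> x}"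
proof -
  have "pairwise (\<lambda>c d. disjnt (set c) (set d)) (nontrivial_cycles n \<pi>)"
    by (rule pairwise_subset[OF pairwise_disjnt_perm_cycles[OF assms]])
      (simp add: nontrivial_cycles_def)
  moreover have "c \<in> cycles_on (set c) \<and> 2 \<le> length c" if "c \<in> nontrivial_cycles n \<pi>" for c
    using that by (simp add: nontrivial_cycles_def perm_cycles_iff[OF assms])
  ultimately show ?thesis
    by (simp add: cycle_partitions_def Union_nontrivial_cycles[OF assms])
qed

lemma inj_on_nontrivial_cycles: "inj_on (nontrivial_cycles n) {\<pi>. \<pi> permutes {1..n}}"
proof (rule inj_onI, rule ext)
  fix \<pi> \<sigma> x
  assume "\<pi> \<in> {\<pi>. \<pi> permutes {1..n}}" "\<sigma> \<in> {\<pi>. \<pi> permutes {1..n}}"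
    and same: "nontrivial_cycles n \<pi> = nontrivial_cycles n \<sigma>"
  then have perm: "\<pi> permutes {1..n}" "\<sigma> permutes {1..n}" by auto
  show "\<pi> x = \<sigma> x"
  proof (cases "x \<in> \<Union> (set ` nontrivial_cycles n \<pi>)")
    case True
    then obtain c where "c \<in> nontrivial_cycles n \<pi>" "c \<in> nontrivial_cycles n \<sigma>" "x \<in> set c"
      using same by auto
    moreover from this have "map \<pi> c = map \<sigma> c"
      by (simp add: nontrivial_cycles_def perm_cycles_iff[OF perm(1)] perm_cycles_iff[OF perm(2)])
    ultimately show ?thesis by simp
  next
    case False
    then have "\<pi> x = x" "\<sigma> x = x"
      using Union_nontrivial_cycles[OF perm(1)] Union_nontrivial_cycles[OF perm(2)] same by auto
    then show ?thesis by simp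
  qed
qed

lemma ex_permutes_map_eq_rotate1:
  assumes "finite K" "\<forall>c\<in>K. distinct c" "pairwise (\<lambda>c d. disjnt (set c) (set d)) K"
  shows "\<exists>\<pi>. \<pi> permutes \<Union> (set ` K) \<and> (\<forall>c\<in>K. map \<pi> c = rotate1 c)"
  using assms
proof (induction K rule: finite_induct)
  case empty
  show ?case by (auto simp: permutes_empty)
next
  case (insert c K)
  then obtain \<pi> where \<pi>: "\<pi> permutes \<Union> (set ` K)" "\<forall>d\<in>K. map \<pi> d = rotate1 d"
    by (auto simp: pairwise_insert)
  have disj: "set d \<inter> set c = {}" if "d \<in> K" for d
    using insert that by (auto simp: pairwise_insert disjnt_def)
  let ?\<sigma> = "cycle_of_list c \<circ> \<pi>"
  have "?\<sigma> permutes \<Union> (set ` insert c K)"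
    by (rule permutes_compose)
      (auto intro: permutes_subset[OF \<pi>(1)] permutes_subset[OF cycle_permutes])
  moreover have "map ?\<sigma> c = rotate1 c"
  proof -
    have "map \<pi> c = c"
      using permutes_not_in[OF \<pi>(1)] disj by (intro map_idI) blast
    then show ?thesis
      using cyclic_rotation[of c 1] insert.prems(1) by (simp flip: map_map)
  qed
  moreover have "map ?\<sigma> d = rotate1 d" if d: "d \<in> K" for d
  proof -
    have "map ?\<sigma> d = map (cycle_of_list c) (rotate1 d)" using \<pi>(2) d by (simp flip: map_map)
    also have "\<dots> = rotate1 d"
      using disj[OF d] by (intro map_idI id_outside_supp) auto
    finally show ?thesis .
  qed
  ultimately show ?case by blast
qed

lemma finite_cycle_partition:
  assumes "finite U" "K \<in> cycle_partitions U"
  shows "finite K"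
proof (rule finite_subset)
  show "K \<subseteq> {c. set c \<subseteq> U \<and> distinct c}"
    using assms(2) by (auto simp: cycle_partitions_def cycles_on_def permutations_of_set_def)
qed (simp add: assms(1) finite_subset_distinct)

lemma ex_permutes_nontrivial_cycles:
  assumes "K \<in> cycle_partitions U" "U \<subseteq> {1..n}"
  shows "\<exists>\<pi>. \<pi> permutes {1..n} \<and> nontrivial_cycles n \<pi> = K"
proof -
  have K: "c \<in> cycles_on (set c)" "distinct c" "2 \<le> length c" "set c \<subseteq> U" if "c \<in> K" for c
    using assms(1) that by (auto simp: cycle_partitions_def cycles_on_def permutations_of_set_def)
  have union: "\<Union> (set ` K) = U" and disj: "pairwise (\<lambda>c d. disjnt (set c) (set d)) K"
    using assms(1) by (auto simp: cycle_partitions_def)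
  have "finite K" using finite_cycle_partition[OF finite_subset[OF assms(2)] assms(1)] by simp
  then obtain \<pi> where \<pi>: "\<pi> permutes U" "\<forall>c\<in>K. map \<pi> c = rotate1 c"
    using ex_permutes_map_eq_rotate1[of K] K(2) disj union by blast
  have perm: "\<pi> permutes {1..n}" by (rule permutes_subset[OF \<pi>(1) assms(2)])
  have sub: "K \<subseteq> nontrivial_cycles n \<pi>"
    using \<pi>(2) K assms(2) perm_cycles_iff[OF perm] unfolding nontrivial_cycles_def by blast
  moreover have "c \<in> K" if c: "c \<in> nontrivial_cycles n \<pi>" for c
  proof -
    have "hd c \<in> set c" using c by (intro hd_in_set) (auto simp: nontrivial_cycles_def)
    then have "\<pi> (hd c) \<noteq> hd c" using c Union_nontrivial_cycles[OF perm] by blast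
    then have "hd c \<in> U" using permutes_not_in[OF \<pi>(1)] by blast
    then obtain d where d: "d \<in> K" "hd c \<in> set d" using union by blast
    then have "\<not> disjnt (set c) (set d)" using \<open>hd c \<in> set c\<close> by (auto simp: disjnt_iff)
    then have "c = d"
      using nontrivial_cycles_in_cycle_partitions[OF perm] c d(1) sub
      by (auto simp: cycle_partitions_def pairwise_def)
    with d show ?thesis by simp
  qed
  ultimately show ?thesis using perm by blast
qed

theorem bij_betw_nontrivial_cycles:
  "bij_betw (nontrivial_cycles n) {\<pi>. \<pi> permutes {1..n}} (\<Union>U\<in>Pow {1..n}. cycle_partitions U)"
proof (rule bij_betw_imageI[OF inj_on_nontrivial_cycles], intro equalityI subsetI)
  fix K assume "K \<in> nontrivial_cycles n ` {\<pi>. \<pi> permutes {1..n}}"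
  then obtain \<pi> where \<pi>: "\<pi> permutes {1..n}" "K = nontrivial_cycles n \<pi>" by blast
  have "{x. \<pi> x \<noteq> x} \<in> Pow {1..n}" using permutes_not_in[OF \<pi>(1)] by blast
  then show "K \<in> (\<Union>U\<in>Pow {1..n}. cycle_partitions U)"
    using nontrivial_cycles_in_cycle_partitions[OF \<pi>(1)] \<pi>(2) by blast
next
  fix K assume "K \<in> (\<Union>U\<in>Pow {1..n}. cycle_partitions U)"
  then show "K \<in> nontrivial_cycles n ` {\<pi>. \<pi> permutes {1..n}}"
    using ex_permutes_nontrivial_cycles by blast
qed

section \<open>Cyclic descents\<close>

lemma cA_add_cD: "cA c + cD c = length c"
proof -
  let ?asc = "{i \<in> {..<length c}. c ! i \<le> c ! (Suc i mod length c)}"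
  let ?desc = "{i \<in> {..<length c}. c ! i > c ! (Suc i mod length c)}"
  have "cA c + cD c = card (?asc \<union> ?desc)"
    unfolding cA_def cD_def by (rule card_Un_disjoint[symmetric]) auto
  also have "?asc \<union> ?desc = {..<length c}" by auto
  finally show ?thesis by simp
qed

lemma two_cycle_M_le_length: "2 * cycle_M c \<le> length c"
  using cA_add_cD[of c] by (simp add: cycle_M_def)

lemma cD_eq_card_list_descents:
  assumes "c \<noteq> []"
  shows "cD c = card (list_descents (c @ [hd c]))"
proof -
  have "(c @ [hd c]) ! Suc i = c ! (Suc i mod length c)" if "i < length c" for i
    using that assms by (cases "Suc i = length c") (simp_all add: nth_append hd_conv_nth)
  then have "list_descents (c @ [hd c]) =
      Suc ` {i \<in> {..<length c}. c ! i > c ! (Suc i mod length c)}"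
    by (auto simp: list_descents_def nth_append)
  then show ?thesis by (simp add: cD_def card_image)
qed

lemma cD_Cons:
  assumes "ys \<noteq> []" "\<forall>y\<in>set ys. x < y"
  shows "cD (x # ys) = Suc (card (list_descents ys))"
proof -
  have single: "list_descents [x] = {}" by (simp add: list_descents_eq_empty_iff)
  have "x < last ys" "x < hd ys" using assms by simp_all
  then have "list_descents ([x] @ ys @ [x]) = Suc ` insert (length ys) (list_descents ys)"
    unfolding list_descents_append[of "[x]"] list_descents_append[of ys]
    using assms(1) by (auto simp: single)
  then have "cD (x # ys) = card (Suc ` insert (length ys) (list_descents ys))"
    by (simp add: cD_eq_card_list_descents)
  also have "\<dots> = card (insert (length ys) (list_descents ys))"
    by (simp only: card_image inj_Suc)
  also have "\<dots> = Suc (card (list_descents ys))"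
    using list_descents_subset[of ys] by (intro card_insert_disjoint) auto
  finally show ?thesis .
qed

lemma cycle_M_pos:
  assumes "c \<in> cycles_on A" "2 \<le> length c"
  shows "0 < cycle_M c"
proof -
  obtain x ys where c: "c = x # ys" using assms(2) by (cases c) auto
  have "ys \<noteq> []" using assms(2) c by auto
  moreover have "\<forall>y\<in>set ys. x < y"
    using assms(1) by (auto simp: cycles_on_def permutations_of_set_def c order.strict_iff_order)
  ultimately have "cD c = Suc (card (list_descents ys))" "card (list_descents ys) < length ys"
    using cD_Cons card_list_descents_less c by auto
  then show ?thesis using cA_add_cD[of c] by (simp add: cycle_M_def c)
qed

definition odd_cycles_on :: "nat set \<Rightarrow> nat \<Rightarrow> nat list set" where
  "odd_cycles_on A m = {c \<in> cycles_on A. odd (length c) \<and> cycle_M c = m}"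

lemma odd_cycles_on_iff:
  "c \<in> odd_cycles_on A m \<longleftrightarrow>
    set c = A \<and> c \<in> cycles_on (set c) \<and> odd (length c) \<and> cycle_M c = m"
  by (auto simp: odd_cycles_on_def cycles_on_def permutations_of_set_def)

lemma finite_odd_cycles_on [simp]: "finite (odd_cycles_on A m)"
  by (simp add: odd_cycles_on_def)

lemma cycle_M_Cons_iff:
  assumes "ys \<noteq> []" "\<forall>y\<in>set ys. x < y" "0 < m" "2 * m < Suc (length ys)"
  shows "cycle_M (x # ys) = m \<longleftrightarrow>
    card (list_descents ys) = m - 1 \<or> card (list_descents ys) = length ys - 1 - (m - 1)"
proof -
  have "cD (x # ys) = Suc (card (list_descents ys))" using cD_Cons[OF assms(1,2)] .
  moreover have "cA (x # ys) + cD (x # ys) = Suc (length ys)" using cA_add_cD[of "x # ys"] by simp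
  ultimately show ?thesis
    using assms(3,4) card_list_descents_less[OF assms(1)] by (auto simp: cycle_M_def min_def)
qed

lemma card_odd_cycles_on:
  assumes "finite A" "odd (card A)" "0 < m" "2 * m < card A"
  shows "card (odd_cycles_on A m) = 2 * card (perms_with_num_descents (A - {Min A}) (m - 1))"
proof -
  let ?B = "A - {Min A}"
  let ?P = "perms_with_num_descents ?B"
  let ?m' = "card ?B - 1 - (m - 1)"
  have "A \<noteq> {}" using assms(4) by auto
  have card_A: "card A = Suc (card ?B)"
    using card.remove[OF assms(1) Min_in[OF assms(1) \<open>A \<noteq> {}\<close>]] .
  have "odd (length (Min A # ys)) \<and> cycle_M (Min A # ys) = m \<longleftrightarrow>
      card (list_descents ys) = m - 1 \<or> card (list_descents ys) = ?m'"
    if ys: "ys \<in> permutations_of_set ?B" for ys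
  proof -
    have len: "length ys = card ?B" using ys by (rule length_finite_permutations_of_set)
    have "\<forall>y\<in>set ys. Min A < y"
      using ys assms(1) by (auto simp: permutations_of_set_def order.strict_iff_order)
    moreover have "ys \<noteq> []" using len card_A assms(3,4) by auto
    ultimately show ?thesis
      using cycle_M_Cons_iff[of ys "Min A" m] len card_A assms(2-4) by simp
  qed
  then have "odd_cycles_on A m = (#) (Min A) ` (?P (m - 1) \<union> ?P ?m')"
    unfolding odd_cycles_on_def cycles_on_eq_image[OF assms(1) \<open>A \<noteq> {}\<close>]
      perms_with_num_descents_def by blast
  then have "card (odd_cycles_on A m) = card (?P (m - 1) \<union> ?P ?m')"
    by (simp add: card_image)
  also have "\<dots> = card (?P (m - 1)) + card (?P ?m')"
    using card_A assms(3,4)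
    by (intro card_Un_disjoint) (auto simp: perms_with_num_descents_def)
  also have "card (?P ?m') = card (?P (m - 1))"
    using card_A assms(3,4) by (intro card_perms_with_num_descents_symmetric) auto
  finally show ?thesis by simp
qed

lemma odd_cycles_on_eq_empty:
  assumes "even (card A) \<or> card A < 2 * m"
  shows "odd_cycles_on A m = {}"
proof -
  have "odd (card A) \<and> 2 * m \<le> card A" if "c \<in> odd_cycles_on A m" for c
    using that two_cycle_M_le_length[of c] length_cycles_on[of c A]
    by (auto simp: odd_cycles_on_def)
  with assms show ?thesis by fastforce
qed

lemma card_odd_cycles_on_1:
  assumes "finite A"
  shows "card (odd_cycles_on A 1) = (if odd (card A) \<and> 3 \<le> card A then 2 else 0)"
proof (cases "odd (card A) \<and> 3 \<le> card A")
  case True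
  then show ?thesis
    using assms by (simp add: card_odd_cycles_on card_perms_with_num_descents_0)
next
  case False
  then have "even (card A) \<or> card A < 2 * 1" by presburger
  with False show ?thesis by (simp only: odd_cycles_on_eq_empty) simp
qed

lemma card_odd_cycles_on_2:
  assumes "finite A"
  shows "int (card (odd_cycles_on A 2)) =
    (if odd (card A) \<and> 5 \<le> card A then 2 ^ card A - 2 * int (card A) else 0)"
proof (cases "odd (card A) \<and> 5 \<le> card A")
  case True
  then have "A \<noteq> {}" by auto
  then have "card (A - {Min A}) = card A - 1" using assms by simp
  moreover have "(2::int) ^ card A = 2 * 2 ^ (card A - 1)"
    using True by (cases "card A") simp_all
  ultimately show ?thesis
    using True assms card_perms_with_num_descents_1[of "A - {Min A}"]
    by (simp add: card_odd_cycles_on of_nat_diff)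
next
  case False
  then have "even (card A) \<or> card A < 2 * 2" by presburger
  with False show ?thesis by (simp only: odd_cycles_on_eq_empty) simp
qed

section \<open>Partitions into odd cycles\<close>

definition odd_cycle_partitions :: "nat set \<Rightarrow> nat \<Rightarrow> nat list set set" where
  "odd_cycle_partitions U d =
     {K \<in> cycle_partitions U. (\<forall>c\<in>K. odd (length c)) \<and> sum cycle_M K = d}"

lemma odd_cycles_and_perm_M_iff:
  assumes "\<pi> permutes {1..n}"
  shows "(\<forall>c\<in>perm_cycles n \<pi>. odd (length c)) \<and> perm_M n \<pi> = d \<longleftrightarrow>
    (\<forall>c\<in>nontrivial_cycles n \<pi>. odd (length c)) \<and> sum cycle_M (nontrivial_cycles n \<pi>) = d"
proof -
  have length_1: "length c = 1" if "c \<in> perm_cycles n \<pi>" "c \<notin> nontrivial_cycles n \<pi>" for c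
  proof -
    have "c \<noteq> []" using that(1) by (simp add: perm_cycles_iff[OF assms] cycles_on_def)
    then have "0 < length c" by simp
    moreover have "\<not> 2 \<le> length c" using that by (simp add: nontrivial_cycles_def)
    ultimately show ?thesis by linarith
  qed
  have "perm_M n \<pi> = sum cycle_M (nontrivial_cycles n \<pi>)"
    unfolding perm_M_def
  proof (rule sum.mono_neutral_right)
    show "\<forall>c\<in>perm_cycles n \<pi> - nontrivial_cycles n \<pi>. cycle_M c = 0"
    proof
      fix c assume "c \<in> perm_cycles n \<pi> - nontrivial_cycles n \<pi>"
      then show "cycle_M c = 0" using length_1[of c] two_cycle_M_le_length[of c] by simp
    qed
  qed (auto simp: finite_perm_cycles nontrivial_cycles_def)
  moreover have "(\<forall>c\<in>perm_cycles n \<pi>. odd (length c)) \<longleftrightarrow>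
      (\<forall>c\<in>nontrivial_cycles n \<pi>. odd (length c))"
    using length_1 by (metis (no_types, lifting) mem_Collect_eq nontrivial_cycles_def odd_one)
  ultimately show ?thesis by simp
qed

lemma odd_cycle_number_eq_sum:
  "odd_cycle_number n d = (\<Sum>U\<in>Pow {1..n}. card (odd_cycle_partitions U d))"
proof -
  let ?K = "\<Union>U\<in>Pow {1..n}. cycle_partitions U"
  let ?Q = "\<lambda>K. (\<forall>c\<in>K. odd (length c)) \<and> sum cycle_M K = d"
  have "bij_betw (nontrivial_cycles n)
      {\<pi> \<in> {\<pi>. \<pi> permutes {1..n}}. (\<forall>c\<in>perm_cycles n \<pi>. odd (length c)) \<and> perm_M n \<pi> = d}
      {K \<in> ?K. ?Q K}"
    by (rule bij_betw_Collect[OF bij_betw_nontrivial_cycles])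
      (simp add: odd_cycles_and_perm_M_iff)
  then have "odd_cycle_number n d = card {K \<in> ?K. ?Q K}"
    unfolding odd_cycle_number_def by (simp add: bij_betw_same_card)
  also have "\<dots> = (\<Sum>U\<in>Pow {1..n}. card {K \<in> {K \<in> ?K. ?Q K}. \<Union> (set ` K) = U})"
  proof (rule card_eq_sum_card_fibres)
    have "finite ?K"
      using bij_betw_finite[OF bij_betw_nontrivial_cycles[of n]] finite_permutations[of "{1..n}"]
      by simp
    then show "finite {K \<in> ?K. ?Q K}" by (rule finite_subset[rotated]) blast
  qed (auto simp: cycle_partitions_def)
  also have "\<dots> = (\<Sum>U\<in>Pow {1..n}. card (odd_cycle_partitions U d))"
    by (intro sum.cong arg_cong[of _ _ card])
      (auto simp: odd_cycle_partitions_def cycle_partitions_def)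
  finally show ?thesis .
qed

definition odd_cycle_pairs :: "nat set \<Rightarrow> nat \<Rightarrow> (nat list \<times> nat list) set" where
  "odd_cycle_pairs U m = (\<Union>A\<in>Pow U. odd_cycles_on A m \<times> odd_cycles_on (U - A) m)"

lemma finite_odd_cycle_pairs [simp]: "finite U \<Longrightarrow> finite (odd_cycle_pairs U m)"
  by (simp add: odd_cycle_pairs_def)

lemma odd_cycle_pairs_iff:
  "(c, d) \<in> odd_cycle_pairs U m \<longleftrightarrow> disjnt (set c) (set d) \<and> set c \<union> set d = U \<and>
    c \<in> odd_cycles_on (set c) m \<and> d \<in> odd_cycles_on (set d) m"
proof
  assume "(c, d) \<in> odd_cycle_pairs U m"
  then obtain A where "A \<subseteq> U" "c \<in> odd_cycles_on A m" "d \<in> odd_cycles_on (U - A) m"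
    by (auto simp: odd_cycle_pairs_def)
  then show "disjnt (set c) (set d) \<and> set c \<union> set d = U \<and>
      c \<in> odd_cycles_on (set c) m \<and> d \<in> odd_cycles_on (set d) m"
    by (auto simp: odd_cycles_on_iff disjnt_def)
next
  assume cd: "disjnt (set c) (set d) \<and> set c \<union> set d = U \<and>
      c \<in> odd_cycles_on (set c) m \<and> d \<in> odd_cycles_on (set d) m"
  then have "set d = U - set c" by (auto simp: disjnt_def)
  with cd show "(c, d) \<in> odd_cycle_pairs U m" by (auto simp: odd_cycle_pairs_def)
qed

lemma singleton_in_odd_cycle_partitions_iff:
  assumes "0 < m"
  shows "{c} \<in> odd_cycle_partitions U m \<longleftrightarrow> c \<in> odd_cycles_on U m"
  using assms two_cycle_M_le_length[of c]
  by (auto simp: odd_cycle_partitions_def cycle_partitions_def odd_cycles_on_iff)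

lemma doubleton_in_odd_cycle_partitions_iff:
  assumes "c \<noteq> d" "cycle_M c = m" "cycle_M d = m" "0 < m"
  shows "{c, d} \<in> odd_cycle_partitions U (2 * m) \<longleftrightarrow> (c, d) \<in> odd_cycle_pairs U m"
  using assms two_cycle_M_le_length[of c] two_cycle_M_le_length[of d]
  by (auto simp: odd_cycle_partitions_def cycle_partitions_def odd_cycle_pairs_iff
      odd_cycles_on_iff pairwise_insert disjnt_sym)

lemma odd_cycle_partitions_2:
  assumes "finite U"
  shows "odd_cycle_partitions U 2 =
    (\<lambda>c. {c}) ` odd_cycles_on U 2 \<union> (\<lambda>(c, d). {c, d}) ` odd_cycle_pairs U 1" (is "_ = ?R")
proof (intro equalityI subsetI)
  fix K assume K: "K \<in> odd_cycle_partitions U 2"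
  then have "finite K" "\<forall>c\<in>K. 0 < cycle_M c" "sum cycle_M K = 2"
    using finite_cycle_partition[OF assms] cycle_M_pos
    by (auto simp: odd_cycle_partitions_def cycle_partitions_def)
  then consider (single) c where "K = {c}"
    | (pair) c d where "c \<noteq> d" "K = {c, d}" "cycle_M c = 1" "cycle_M d = 1"
    using sum_eq_2_iff by metis
  then show "K \<in> ?R"
  proof cases
    case single
    then show ?thesis using K singleton_in_odd_cycle_partitions_iff[of 2] by auto
  next
    case pair
    then show ?thesis using K doubleton_in_odd_cycle_partitions_iff[of c d 1] by auto
  qed
next
  fix K assume "K \<in> ?R"
  then consider (single) c where "K = {c}" "c \<in> odd_cycles_on U 2"
    | (pair) c d where "K = {c, d}" "(c, d) \<in> odd_cycle_pairs U 1" by auto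
  then show "K \<in> odd_cycle_partitions U 2"
  proof cases
    case single
    then show ?thesis using singleton_in_odd_cycle_partitions_iff[of 2] by simp
  next
    case pair
    then have "c \<noteq> d" "cycle_M c = 1" "cycle_M d = 1"
      by (auto simp: odd_cycle_pairs_iff odd_cycles_on_iff cycles_on_def)
    with pair show ?thesis using doubleton_in_odd_cycle_partitions_iff[of c d 1] by simp
  qed
qed

lemma card_odd_cycle_pairs:
  assumes "finite U"
  shows "card (odd_cycle_pairs U m) =
    (\<Sum>A\<in>Pow U. card (odd_cycles_on A m) * card (odd_cycles_on (U - A) m))"
  unfolding odd_cycle_pairs_def using assms
  by (subst card_UN_disjoint) (auto simp: odd_cycles_on_iff card_cartesian_product)

lemma card_odd_cycle_pairs_1_eq_sum:
  assumes "finite U"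
  shows "card (odd_cycle_pairs U 1) =
    (if even (card U) then 4 * (\<Sum>k | odd k \<and> 3 \<le> k \<and> k + 3 \<le> card U. card U choose k) else 0)"
proof -
  let ?n = "card U"
  let ?I = "{k. odd k \<and> 3 \<le> k \<and> k + 3 \<le> ?n}"
  let ?g = "\<lambda>k. (if odd k \<and> 3 \<le> k then 2 else 0 :: nat)"
  have "card (odd_cycle_pairs U 1) = (\<Sum>A\<in>Pow U. ?g (card A) * ?g (?n - card A))"
    unfolding card_odd_cycle_pairs[OF assms]
  proof (rule sum.cong[OF refl])
    fix A assume "A \<in> Pow U"
    then have "finite A" "finite (U - A)" "card (U - A) = ?n - card A"
      using assms by (auto simp: card_Diff_subset finite_subset)
    then show "card (odd_cycles_on A 1) * card (odd_cycles_on (U - A) 1) =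
        ?g (card A) * ?g (?n - card A)"
      by (simp only: card_odd_cycles_on_1)
  qed
  also have "\<dots> = (\<Sum>k\<le>?n. (?n choose k) * (?g k * ?g (?n - k)))"
    using sum_Pow_card[OF assms, of "\<lambda>k. ?g k * ?g (?n - k)"] by simp
  also have "\<dots> = (\<Sum>k\<le>?n. if k \<in> ?I then if even ?n then 4 * (?n choose k) else 0 else 0)"
    by (rule sum.cong) auto
  also have "\<dots> = (\<Sum>k\<in>{..?n} \<inter> ?I. if even ?n then 4 * (?n choose k) else 0)"
    by (rule sum.inter_restrict[symmetric]) simp
  also have "{..?n} \<inter> ?I = ?I" by auto
  finally show ?thesis by (simp add: sum_distrib_left)
qed

lemma card_odd_cycle_pairs_1:
  assumes "finite U"
  shows "int (card (odd_cycle_pairs U 1)) =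
    (if even (card U) \<and> 4 \<le> card U then 2 * (2 ^ card U - 4 * int (card U)) else 0)"
proof (cases "even (card U) \<and> 4 \<le> card U")
  case True
  then have "(2::int) ^ card U = 2 * 2 ^ (card U - 1)" by (cases "card U") simp_all
  with True show ?thesis
    using arg_cong[OF sum_choose_odd_inner[of "card U"], of int]
    unfolding card_odd_cycle_pairs_1_eq_sum[OF assms] by simp
next
  case False
  then have "{k. odd k \<and> 3 \<le> k \<and> k + 3 \<le> card U} = {} \<or> odd (card U)" by auto
  with False show ?thesis unfolding card_odd_cycle_pairs_1_eq_sum[OF assms] by auto
qed

lemma card_odd_cycle_partitions_2:
  assumes "finite U"
  shows "int (card (odd_cycle_partitions U 2)) =
    (if card U \<le> 3 then 0 else 2 ^ card U - (3 + (-1) ^ card U) * int (card U))"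
proof -
  have "finite (odd_cycle_pairs U 1)" using assms by simp
  moreover have "sym (odd_cycle_pairs U 1)"
    by (auto intro!: symI simp: odd_cycle_pairs_iff disjnt_sym)
  moreover have "irrefl (odd_cycle_pairs U 1)"
    by (auto simp: irrefl_def odd_cycle_pairs_iff odd_cycles_on_iff cycles_on_def)
  ultimately have pairs:
    "2 * card ((\<lambda>(c, d). {c, d}) ` odd_cycle_pairs U 1) = card (odd_cycle_pairs U 1)"
    by (rule two_card_unordered_pairs)
  have "card (odd_cycle_partitions U 2) =
      card ((\<lambda>c. {c}) ` odd_cycles_on U 2) + card ((\<lambda>(c, d). {c, d}) ` odd_cycle_pairs U 1)"
    unfolding odd_cycle_partitions_2[OF assms]
  proof (rule card_Un_disjoint)
    show "(\<lambda>c. {c}) ` odd_cycles_on U 2 \<inter> (\<lambda>(c, d). {c, d}) ` odd_cycle_pairs U 1 = {}"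
      using \<open>irrefl (odd_cycle_pairs U 1)\<close> by (fastforce simp: irrefl_def)
  qed (use assms in simp_all)
  then have "2 * int (card (odd_cycle_partitions U 2)) =
      2 * int (card (odd_cycles_on U 2)) + int (card (odd_cycle_pairs U 1))"
    using pairs by (simp add: card_image)
  then have count: "2 * int (card (odd_cycle_partitions U 2)) =
      2 * (if odd (card U) \<and> 5 \<le> card U then 2 ^ card U - 2 * int (card U) else 0) +
      (if even (card U) \<and> 4 \<le> card U then 2 * (2 ^ card U - 4 * int (card U)) else 0)"
    by (simp only: card_odd_cycles_on_2[OF assms] card_odd_cycle_pairs_1[OF assms])
  consider (small) "card U \<le> 3" | (odd) "odd (card U)" "5 \<le> card U"
    | (even) "even (card U)" "4 \<le> card U" by atomize_elim presburger
  then show ?thesis using count by cases simp_all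
qed

theorem odd_cycle_number_2:
  assumes "2 \<le> n"
  shows "int (odd_cycle_number n 2) =
    3 ^ n - 3 * int n * 2 ^ (n - 1) + 4 * int (n choose 2) - 2 * int (n choose 3) - 1"
proof -
  (* ?e is the error of the formula for k > 3; it vanishes except at k = 0, 2, 3. *)
  let ?w = "\<lambda>k. if k \<le> 3 then 0 else 2 ^ k - (3 + (-1) ^ k) * int k"
  let ?e = "\<lambda>k :: nat. if k = 0 then 1 else if k = 2 then -4 else if k = 3 then 2 else 0 :: int"
  have "int (odd_cycle_number n 2) = (\<Sum>U\<in>Pow {1..n}. ?w (card U))"
    unfolding odd_cycle_number_eq_sum of_nat_sum
    by (intro sum.cong card_odd_cycle_partitions_2) (auto intro: finite_subset)
  also have "\<dots> = (\<Sum>k\<le>n. int (n choose k) * ?w k)"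
    using sum_Pow_card[of "{1..n}" ?w] by simp
  also have "\<dots> = (\<Sum>k\<le>n. int (n choose k) * 2 ^ k - 3 * int (k * (n choose k))
      - (-1) ^ k * int k * int (n choose k) - int (n choose k) * ?e k)"
  proof (rule sum.cong[OF refl])
    fix k :: nat
    have "k \<in> {0, 1, 2, 3} \<or> 3 < k" by auto
    then have w: "?w k = 2 ^ k - (3 + (-1) ^ k) * int k - ?e k" by auto
    show "int (n choose k) * ?w k = int (n choose k) * 2 ^ k - 3 * int (k * (n choose k))
        - (-1) ^ k * int k * int (n choose k) - int (n choose k) * ?e k"
      unfolding w by (simp only: of_nat_mult algebra_simps)
  qed
  also have "\<dots> = (\<Sum>k\<le>n. int (n choose k) * 2 ^ k) - 3 * int (\<Sum>k\<le>n. k * (n choose k))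
      - (\<Sum>k\<le>n. (-1) ^ k * int k * int (n choose k)) - (\<Sum>k\<le>n. int (n choose k) * ?e k)"
    by (simp add: sum_subtractf sum_distrib_left)
  also have "(\<Sum>k\<le>n. int (n choose k) * 2 ^ k) = 3 ^ n"
    using binomial_ring[of "2 :: int" 1 n] by simp
  also have "(\<Sum>k\<le>n. k * (n choose k)) = n * 2 ^ (n - 1)" by (rule choose_linear_sum)
  also have "(\<Sum>k\<le>n. (-1) ^ k * int k * int (n choose k)) = 0"
    using assms by (intro choose_alternating_linear_sum) simp
  also have "(\<Sum>k\<le>n. int (n choose k) * ?e k) = (\<Sum>k\<in>{0, 2, 3}. int (n choose k) * ?e k)"
    by (rule sum.mono_neutral_cong) auto
  finally show ?thesis by simp
qed

theorem theorem1p4: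
  fixes n :: nat
  assumes "n \<ge> 2"
  shows "ballot_number n 2 = odd_cycle_number n 2 \<and>
         int (odd_cycle_number n 2) =
           3 * int (eulerian (n - 1) 2) - 2 * int (n choose 3) + int (n choose 2) - 1"
proof -
  have "ballot_number n 2 = odd_cycle_number n 2"
    using ballot_number_2[OF assms] odd_cycle_number_2[OF assms] by linarith
  moreover have "int (eulerian (n - 1) 2) = 3 ^ (n - 1) - int n * 2 ^ (n - 1) + int (n choose 2)"
    using eulerian_2[of "n - 1"] assms by simp
  moreover have "(3::int) ^ n = 3 * 3 ^ (n - 1)"
    using assms by (cases n) simp_all
  ultimately show ?thesis
    using odd_cycle_number_2[OF assms] by linarith
qed

end
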